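(* Let $(s,t)\in\mathbb{Q}^2-\mathbb{Z}^2$ and let $r\in\mathbb{Z}-\{0\}$ be such that $(rs,rt)\notin\mathbb{Z}^2$. Then the function $$h_{r,(s,t)}(\tau):=r\,g_{(s,t)}(\tau)-g_{(rs,rt)}(\tau)$$ on $\mathbb{H}$ is an elliptic modular form of weight $1$ with respect to $\Gamma_{(s,t)}$.
   Context: $\mathbb{H}=\{\tau\in\mathbb{C}\mid \operatorname{Im}\tau>0\}$. For a lattice $\Omega\subset\mathbb{C}$ (a $\mathbb{Z}$-module generated by two $\mathbb{R}$-linearly independent elements), the Weierstrass $\zeta$-function is $$\zeta(\Omega,z)=\frac{1}{z}+\sum_{\omega\in\Omega-\{0\}}\left(\frac{1}{z-\omega}+\frac{1}{\omega}+\frac{z}{\omega^2}\right),$$ and $\zeta(\tau,z):=\zeta(\tau\mathbb{Z}+\mathbb{Z},z)$ for $\tau\in\mathbb{H}$. For $(s,t)\in\mathbb{Q}^2-\mathbb{Z}^2$, $g_{(s,t)}(\tau):=\zeta(\tau,s\tau+t)$, a holomorphic function on $\mathbb{H}$. For $(s,t)\in\mathbb{Q}^2$ and $A=\begin{pmatrix}a&b\\c&d\end{pmatrix}\in\mathrm{SL}(2,\mathbb{Z})$, $(s,t)A=(sa+tc,\,sb+td)$ is the product of a row vector and a matrix, and $$\Gamma_{(s,t)}:=\{A\in\mathrm{SL}(2,\mathbb{Z})\mid (s,t)A-(s,t)\in\mathbb{Z}^2\},$$ which contains the principal congruence subgroup $\Gamma(L)$, where $L$ is a common denominator of $s$ and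 $t$. An elliptic modular form of weight $k$ with respect to such a group $\Gamma$ is a holomorphic function $f$ on $\mathbb{H}$ with $f|_kA=f$ for all $A\in\Gamma$, where $(f|_kA)(\tau)=(c\tau+d)^{-k}f\left(\frac{a\tau+b}{c\tau+d}\right)$, and which is holomorphic at every cusp (equivalently, for every $A\in\mathrm{SL}(2,\mathbb{Z})$, $f|_kA$ is bounded on $\{\operatorname{Im}\tau>C\}$ for some $C>0$). *)

theory Defs
  imports "HOL-Complex_Analysis.Complex_Analysis" "HOL-Library.Product_Plus"
begin

definition upper_half_plane :: "complex set" where
  "upper_half_plane = {\<tau>. Im \<tau> > 0}"

definition SL2Z :: "(int ^ 2 ^ 2) set" where
  "SL2Z = {A. det A = 1}"

text \<open>
  This is a lattice (of rank two over the reals) precisely when \<open>\<tau>\<close> is not real.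
\<close>

definition tau_lattice :: "complex \<Rightarrow> complex set" where
  "tau_lattice \<tau> = {of_int m * \<tau> + of_int n |m n. True}"

text \<open>
  The sum is unconditional. For a lattice \<open>\<Omega>\<close> and \<open>z \<notin> \<Omega>\<close> it converges absolutely;
  outside this case the value carries no meaning.
\<close>

definition weierstrass_zeta :: "complex set \<Rightarrow> complex \<Rightarrow> complex" where
  "weierstrass_zeta \<Omega> z =
     1 / z + (\<Sum>\<^sub>\<infinity>\<omega>\<in>\<Omega> - {0}. 1 / (z - \<omega>) + 1 / \<omega> + z / \<omega> ^ 2)"

definition g_fun :: "rat \<times> rat \<Rightarrow> complex \<Rightarrow> complex" where
  "g_fun = (\<lambda>(s, t) \<tau>. weierstrass_zeta (tau_lattice \<tau>) (of_rat s * \<tau> + of_rat t))"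

definition h_fun :: "int \<Rightarrow> rat \<times> rat \<Rightarrow> complex \<Rightarrow> complex" where
  "h_fun r = (\<lambda>(s, t) \<tau>. of_int r * g_fun (s, t) \<tau> - g_fun (of_int r * s, of_int r * t) \<tau>)"

definition row_act :: "rat \<times> rat \<Rightarrow> int ^ 2 ^ 2 \<Rightarrow> rat \<times> rat" where
  "row_act = (\<lambda>(s, t) A.
     (s * of_int (A $ 1 $ 1) + t * of_int (A $ 2 $ 1),
      s * of_int (A $ 1 $ 2) + t * of_int (A $ 2 $ 2)))"

definition Gamma_pt :: "rat \<times> rat \<Rightarrow> (int ^ 2 ^ 2) set" where
  "Gamma_pt p = {A \<in> SL2Z. row_act p A - p \<in> \<int> \<times> \<int>}"

definition slash :: "int \<Rightarrow> (complex \<Rightarrow> complex) \<Rightarrow> int ^ 2 ^ 2 \<Rightarrow> complex \<Rightarrow> complex" where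
  "slash k f A \<tau> =
     (let a = of_int (A $ 1 $ 1); b = of_int (A $ 1 $ 2);
          c = of_int (A $ 2 $ 1); d = of_int (A $ 2 $ 2)
      in (c * \<tau> + d) powi (- k) * f ((a * \<tau> + b) / (c * \<tau> + d)))"

text \<open>
  Functions on the upper half plane are total functions on \<open>complex\<close> of which only the values on
  \<open>upper_half_plane\<close> matter. Holomorphy at the cusps is boundedness of every \<open>SL2Z\<close>-translate
  near \<open>\<i>\<infinity>\<close>, where the half plane of boundedness may depend on the translate.
\<close>

definition modular_form :: "int \<Rightarrow> (int ^ 2 ^ 2) set \<Rightarrow> (complex \<Rightarrow> complex) \<Rightarrow> bool" where
  "modular_form k \<Gamma> f \<longleftrightarrow>
     f holomorphic_on upper_half_plane \<and>
     (\<forall>A\<in>\<Gamma>. \<forall>\<tau>\<in>upper_half_plane. slash k f A \<tau> = f \<tau>) \<and>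
     (\<forall>A\<in>SL2Z. \<exists>C>0. bounded (slash k f A ` {\<tau>. Im \<tau> > C}))"

end

theory Submission
  imports Defs
begin

text \<open>
  Put \<open>z = s\<tau> + t\<close> and \<open>\<Lambda> = \<int>\<tau> + \<int>\<close>, so that the function in question is \<open>r \<zeta>(z) - \<zeta>(rz)\<close>. In this
  combination the terms of the two \<open>\<zeta>\<close>-series that are linear in \<open>z\<close> cancel, and since \<open>1 / 0 = 0\<close>
  the poles at the origin fit into the same pattern; the function is the sum over all \<open>\<omega> \<in> \<Lambda>\<close> of
  \<open>r / (z - \<omega>) - 1 / (rz - \<omega>) + (r - 1) / \<omega>\<close> (\<open>h_fun_has_sum\<close>). For \<open>\<omega> \<noteq> 0\<close> this term equals
  \<open>r (r - 1) z\<^sup>2 / (\<omega> (z - \<omega>) (rz - \<omega>))\<close>, which decays like the cube of \<open>1 / \<omega>\<close>. Everything is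
  read off from this one series.

  Weight one: \<open>\<zeta>\<close> is homogeneous of degree \<open>-1\<close> in the lattice and the argument together, and
  \<open>\<tau> \<mapsto> A\<tau>\<close> replaces the lattice by a homothetic one. Hence slashing with \<open>A\<close> turns the function of
  \<open>(s, t)\<close> into the function of \<open>(s, t)A\<close> (\<open>slash_h_fun\<close>), and it remains to see that the function
  depends on \<open>(s, t)\<close> modulo \<open>\<int>\<^sup>2\<close> only. When \<open>z\<close> moves by a multiple of a basis vector \<open>b\<close> of \<open>\<Lambda>\<close>, the
  change of the series telescopes along every line parallel to \<open>b\<close>: \<open>z\<close> moves by \<open>k\<close> steps and
  \<open>rz\<close> by \<open>rk\<close> steps. So every line contributes zero (\<open>h_sum_lattice_shift\<close>); the
  quasi-periods of \<open>\<zeta>\<close> never enter.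

  Holomorphy and growth: if \<open>N\<close> is a common denominator of \<open>s\<close> and \<open>t\<close>, then \<open>N (z - \<omega>)\<close> is a nonzero
  lattice vector, so a lower bound for nonzero lattice vectors also bounds \<open>z - \<omega>\<close> and \<open>rz - \<omega>\<close> away
  from zero, with explicit dependence on \<open>\<tau>\<close> (\<open>torsion_point_distance_lower_bound\<close>). This gives
  a majorant that is locally uniform in \<open>\<tau>\<close>, hence holomorphy by the Weierstrass test, and
  growth at most quadratic in \<open>Im \<tau>\<close> on vertical strips.

  Cusps: by \<open>slash_h_fun\<close> each slash translate is a function of the same type, so only the
  behaviour at \<open>\<i>\<infinity>\<close> matters. There the function is periodic, hence a function of \<open>q\<close> on a punctured
  disc, and polynomial growth in \<open>Im \<tau> = O(log (1 / \<bar>q\<bar>))\<close> makes the singularity at \<open>q = 0\<close> removable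
  (\<open>periodic_polynomial_growth_imp_bounded\<close>).
\<close>

section \<open>Lower bounds for lattice vectors\<close>

definition lattice_weight :: "int \<times> int \<Rightarrow> real" where
  "lattice_weight x = 1 + \<bar>real_of_int (fst x)\<bar> + \<bar>real_of_int (snd x)\<bar>"

lemma lattice_weight_pos: "lattice_weight x > 0"
  by (simp add: lattice_weight_def)

definition lattice_point :: "complex \<Rightarrow> int \<times> int \<Rightarrow> complex" where
  "lattice_point \<tau> = (\<lambda>(m, n). of_int m * \<tau> + of_int n)"

lemma lattice_point_eq_0_iff:
  assumes "Im \<tau> > 0" shows "lattice_point \<tau> x = 0 \<longleftrightarrow> x = (0, 0)"
proof (cases x)
  case (Pair m n)
  have "Im (lattice_point \<tau> x) = of_int m * Im \<tau>" "Re (lattice_point \<tau> x) = of_int m * Re \<tau> + of_int n"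
    by (simp_all add: Pair lattice_point_def)
  then show ?thesis using assms by (auto simp: Pair complex_eq_iff)
qed

lemma inj_lattice_point:
  assumes "Im \<tau> > 0" shows "inj (lattice_point \<tau>)"
proof (rule injI)
  fix x y :: "int \<times> int"
  assume "lattice_point \<tau> x = lattice_point \<tau> y"
  then have "lattice_point \<tau> (x - y) = 0"
    by (auto simp: lattice_point_def algebra_simps split: prod.splits)
  then show "x = y" using lattice_point_eq_0_iff[OF assms]
    by (simp add: prod_eq_iff)
qed

text \<open>
  Up to a factor, this bounds the quotient of the weight and the norm over all nonzero lattice
  vectors. Its continuity in \<open>\<tau>\<close> will give locally uniform convergence, and its boundedness when \<open>Im \<tau>\<close>
  tends to infinity in a vertical strip will give polynomial growth.
\<close>

definition lattice_distortion :: "complex \<Rightarrow> real" where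
  "lattice_distortion \<tau> = 1 + (1 + norm \<tau>) / Im \<tau>"

lemma lattice_distortion_ge_1: "Im \<tau> > 0 \<Longrightarrow> lattice_distortion \<tau> \<ge> 1"
  by (simp add: lattice_distortion_def)

text \<open>
  The imaginary part of the lattice vector controls \<open>m\<close>; the triangle inequality then controls \<open>n\<close>.
\<close>

lemma lattice_point_lower_bound:
  assumes "Im \<tau> > 0" "(m, n) \<noteq> (0, 0)"
  shows "lattice_weight (m, n) \<le> 2 * lattice_distortion \<tau> * norm (lattice_point \<tau> (m, n))"
proof -
  define w where "w = of_int m * \<tau> + of_int n"
  have "\<bar>real_of_int m\<bar> * Im \<tau> = \<bar>Im w\<bar>"
    using assms by (simp add: w_def abs_mult)
  also have "\<dots> \<le> norm w" by (rule abs_Im_le_cmod)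
  finally have m: "\<bar>real_of_int m\<bar> \<le> norm w / Im \<tau>"
    using assms by (simp add: field_simps)
  have "\<bar>real_of_int n\<bar> = norm (w - of_int m * \<tau>)"
    by (simp add: w_def)
  also have "\<dots> \<le> norm w + \<bar>real_of_int m\<bar> * norm \<tau>"
    using norm_triangle_ineq4[of w "of_int m * \<tau>"] by (simp add: norm_mult)
  also have "\<dots> \<le> norm w + norm w / Im \<tau> * norm \<tau>"
    by (intro add_left_mono mult_right_mono m) auto
  finally have "\<bar>real_of_int m\<bar> + \<bar>real_of_int n\<bar> \<le> lattice_distortion \<tau> * norm w"
    using m by (simp add: lattice_distortion_def algebra_simps add_divide_distrib)
  moreover have "1 \<le> \<bar>real_of_int m\<bar> + \<bar>real_of_int n\<bar>"
    using assms(2) by (auto; linarith)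
  ultimately show ?thesis
    unfolding lattice_weight_def lattice_point_def w_def by simp
qed

lemma rat_common_denominator:
  fixes s t :: rat
  obtains N p q :: int where "N > 0" "of_int N * s = of_int p" "of_int N * t = of_int q"
proof -
  obtain a b where a: "quotient_of s = (a, b)" by (cases "quotient_of s")
  obtain c d where c: "quotient_of t = (c, d)" by (cases "quotient_of t")
  have "b > 0" "d > 0" "s = of_int a / of_int b" "t = of_int c / of_int d"
    using a c quotient_of_denom_pos quotient_of_div by auto
  then show ?thesis
    by (intro that[of "b * d" "a * d" "b * c"]) auto
qed

definition torsion_point :: "rat \<times> rat \<Rightarrow> complex \<Rightarrow> complex" where
  "torsion_point p \<tau> = of_rat (fst p) * \<tau> + of_rat (snd p)"

lemma of_int_times_torsion_point:
  "of_int r * torsion_point (s, t) \<tau> = torsion_point (of_int r * s, of_int r * t) \<tau>"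
  by (simp add: torsion_point_def of_rat_mult algebra_simps)

text \<open>
  Multiplication by a common denominator \<open>N\<close> of \<open>s\<close> and \<open>t\<close> turns \<open>z - \<omega>\<close> into a lattice vector, which
  is nonzero because \<open>(s, t)\<close> is not integral. So the previous bound applies, and the constant \<open>c\<close> depends
  on \<open>(s, t)\<close> only. One estimate covers both the growth for large \<open>\<omega>\<close> and the distance to
  the nearest lattice points.
\<close>

lemma torsion_point_distance_lower_bound:
  assumes "(s, t) \<notin> \<int> \<times> \<int>"
  obtains c where "c > 0" "\<And>\<tau> x. Im \<tau> > 0 \<Longrightarrow>
     lattice_weight x \<le> c * lattice_distortion \<tau> * norm (torsion_point (s, t) \<tau> - lattice_point \<tau> x)"
proof -
  obtain N p q :: int where N: "N > 0" "of_int N * s = of_int p" "of_int N * t = of_int q"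
    by (rule rat_common_denominator)
  define B where "B = 1 + \<bar>real_of_int p\<bar> + \<bar>real_of_int q\<bar>"
  have B: "B \<ge> 1" by (simp add: B_def)
  show thesis
  proof
    show "2 * B * of_int N > 0" using N B by simp
  next
    fix \<tau> :: complex and x :: "int \<times> int"
    assume \<tau>: "Im \<tau> > 0"
    obtain m n where x: "x = (m, n)" by (cases x)
    define w where "w = of_rat s * \<tau> + of_rat t - (of_int m * \<tau> + of_int n)"
    define i j where "i = p - N * m" and "j = q - N * n"
    have "(of_int N :: complex) * of_rat s = of_rat (of_int N * s)"
         "(of_int N :: complex) * of_rat t = of_rat (of_int N * t)"
      by (simp_all add: of_rat_mult)
    then have Nst: "(of_int N :: complex) * of_rat s = of_int p" "(of_int N :: complex) * of_rat t = of_int q"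
      using N by simp_all
    have w: "of_int N * w = of_int i * \<tau> + of_int j"
      by (simp add: w_def i_def j_def algebra_simps Nst[symmetric])
    have "(i, j) \<noteq> (0, 0)"
    proof
      assume "(i, j) = (0, 0)"
      then have "of_int N * s = of_int N * of_int m" "of_int N * t = of_int N * of_int n"
        using N by (simp_all add: i_def j_def flip: of_int_mult)
      then have "s = of_int m" "t = of_int n" using N(1) by simp_all
      then show False using assms by simp
    qed
    from lattice_point_lower_bound[OF \<tau> this]
    have *: "1 + \<bar>real_of_int i\<bar> + \<bar>real_of_int j\<bar> \<le> 2 * lattice_distortion \<tau> * (of_int N * norm w)"
      using N(1) by (simp add: lattice_weight_def lattice_point_def norm_mult flip: w)
    \<comment> \<open>The coordinates \<open>m\<close>, \<open>n\<close> exceed those of \<open>N (z - \<omega>)\<close> by a constant at most, so the weights are comparable.\<close>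
    have mn: "\<bar>m\<bar> \<le> \<bar>i\<bar> + \<bar>p\<bar>" if "i = p - N * m" for m i p
    proof -
      have "\<bar>m\<bar> \<le> \<bar>N * m\<bar>"
        using N(1) mult_right_mono[of 1 N "\<bar>m\<bar>"] by (simp add: abs_mult)
      then show ?thesis using that by linarith
    qed
    have "\<bar>real_of_int m\<bar> \<le> \<bar>real_of_int i\<bar> + \<bar>real_of_int p\<bar>"
         "\<bar>real_of_int n\<bar> \<le> \<bar>real_of_int j\<bar> + \<bar>real_of_int q\<bar>"
      using mn[OF i_def] mn[OF j_def] by (simp_all flip: of_int_abs of_int_add)
    then have "1 + \<bar>real_of_int m\<bar> + \<bar>real_of_int n\<bar> \<le> B + (\<bar>real_of_int i\<bar> + \<bar>real_of_int j\<bar>)"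
      by (simp add: B_def)
    also have "\<dots> \<le> B * (1 + \<bar>real_of_int i\<bar> + \<bar>real_of_int j\<bar>)"
      using B mult_right_mono[OF B, of "\<bar>real_of_int i\<bar> + \<bar>real_of_int j\<bar>"] by (simp add: algebra_simps)
    also have "\<dots> \<le> B * (2 * lattice_distortion \<tau> * (of_int N * norm w))"
      using B * by (intro mult_left_mono) auto
    finally show "lattice_weight x
       \<le> 2 * B * of_int N * lattice_distortion \<tau> * norm (torsion_point (s, t) \<tau> - lattice_point \<tau> x)"
      by (simp add: x w_def lattice_weight_def lattice_point_def torsion_point_def mult_ac)
  qed
qed

lemma torsion_point_not_in_lattice:
  assumes "Im \<tau> > 0" "(s, t) \<notin> \<int> \<times> \<int>"
  shows "torsion_point (s, t) \<tau> \<noteq> lattice_point \<tau> x"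
proof -
  obtain c where "lattice_weight x \<le> c * lattice_distortion \<tau> * norm (torsion_point (s, t) \<tau> - lattice_point \<tau> x)"
    by (rule torsion_point_distance_lower_bound[OF assms(2)], use assms(1) in blast)
  with lattice_weight_pos[of x] show ?thesis by auto
qed

section \<open>The defining series as an absolutely convergent sum over pairs of integers\<close>

text \<open>
  Since \<open>(1 + \<bar>m\<bar>) (1 + \<bar>n\<bar>) \<le> (1 + \<bar>m\<bar> + \<bar>n\<bar>)\<^sup>2\<close>, the double series is dominated by a product of two
  single series with exponent \<open>3 / 2 > 1\<close>.
\<close>

lemma summable_inverse_cube_lattice_weight:
  "(\<lambda>x. 1 / lattice_weight x ^ 3) summable_on UNIV"
proof -
  define v :: "int \<Rightarrow> real" where "v m = (1 + \<bar>real_of_int m\<bar>) powr (- 3 / 2)" for m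
  have nat: "(\<lambda>n::nat. (1 + real n) powr (- 3 / 2)) summable_on UNIV"
  proof (rule summable_nonneg_imp_summable_on)
    have "summable (\<lambda>n::nat. real (Suc n) powr (- 3 / 2))"
      by (subst summable_Suc_iff) (simp add: summable_real_powr_iff)
    then show "summable (\<lambda>n::nat. (1 + real n) powr (- 3 / 2))"
      by (simp add: add.commute)
  qed auto
  have "v summable_on (range int)"
    by (subst summable_on_reindex) (use nat in \<open>auto simp: o_def v_def\<close>)
  moreover have "v summable_on (range (\<lambda>n. - int n))"
    by (subst summable_on_reindex) (use nat in \<open>auto simp: o_def v_def inj_def\<close>)
  ultimately have "v summable_on (range int \<union> range (\<lambda>n. - int n))"
    by (rule summable_on_union)
  also have "range int \<union> range (\<lambda>n. - int n) = UNIV"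
    by (auto simp: image_iff) (metis int_cases2)
  finally have v: "v summable_on UNIV" .
  have v_nonneg: "v m \<ge> 0" for m by (simp add: v_def)
  have "(\<lambda>(m, n). v m * v n) summable_on (SIGMA m:UNIV. UNIV)"
    by (rule summable_on_SigmaI[where g = "\<lambda>m. v m * infsum v UNIV"])
       (use v v_nonneg in \<open>auto intro!: has_sum_cmult_right has_sum_infsum summable_on_cmult_left\<close>)
  then have "(\<lambda>(m, n). v m * v n) summable_on UNIV"
    by simp
  then show ?thesis
  proof (rule summable_on_comparison_test)
    fix x :: "int \<times> int"
    obtain m n where x: "x = (m, n)" by (cases x)
    define a b where "a = \<bar>real_of_int m\<bar>" and "b = \<bar>real_of_int n\<bar>"
    have ab: "a \<ge> 0" "b \<ge> 0" by (auto simp: a_def b_def)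
    have "((1 + a) * (1 + b)) powr (3 / 2) \<le> ((1 + a + b) ^ 2) powr (3 / 2)"
      by (rule powr_mono2) (use ab in \<open>auto simp: power2_eq_square algebra_simps\<close>)
    also have "\<dots> = (1 + a + b) ^ 3"
    proof -
      have "((1 + a + b) ^ 2) powr (3 / 2) = ((1 + a + b) powr 2) powr (3 / 2)"
        using ab by simp
      also have "\<dots> = (1 + a + b) powr (2 * (3 / 2))" by (rule powr_powr)
      also have "\<dots> = (1 + a + b) powr real 3" by simp
      also have "\<dots> = (1 + a + b) ^ 3" using ab by (intro powr_realpow) auto
      finally show ?thesis .
    qed
    finally have "1 / (1 + a + b) ^ 3 \<le> 1 / ((1 + a) * (1 + b)) powr (3 / 2)"
      using ab by (intro divide_left_mono) auto
    also have "\<dots> = v m * v n"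
      using ab by (simp add: v_def a_def[symmetric] b_def[symmetric] powr_mult powr_minus_divide)
    finally show "1 / lattice_weight x ^ 3 \<le> (case x of (m, n) \<Rightarrow> v m * v n)"
      by (simp add: x a_def b_def lattice_weight_def)
  qed (use lattice_weight_pos in \<open>auto intro: less_imp_le\<close>)
qed

lemma summable_lattice_weight: "(\<lambda>x. C / lattice_weight x ^ 3) summable_on A"
proof -
  have "(\<lambda>x. C / lattice_weight x ^ 3) summable_on UNIV"
    using summable_on_cmult_right[OF summable_inverse_cube_lattice_weight, of C] by simp
  then show ?thesis by (rule summable_on_subset_banach) simp
qed

text \<open>
  All summands have the shape \<open>1 / (f g h)\<close> with three factors of linear size in \<open>\<omega>\<close>, each bounded below
  by the weight \<open>u\<close> up to a constant and the factor \<open>L\<close> that depends on \<open>\<tau>\<close>.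
\<close>

lemma norm_inverse_triple_product_le:
  fixes f g h :: complex and L u a b c :: real
  assumes "u > 0" "u \<le> a * L * norm f" "u \<le> b * L * norm g" "u \<le> c * L * norm h"
    and "a > 0" "b > 0" "c > 0" "L > 0"
  shows "norm (1 / (f * g * h)) \<le> a * b * c * L ^ 3 / u ^ 3"
proof -
  define P where "P = a * b * c * L ^ 3"
  have P: "P > 0" using assms by (simp add: P_def)
  have "u ^ 3 \<le> (a * L * norm f) * (b * L * norm g) * (c * L * norm h)"
    unfolding power3_eq_cube using assms by (intro mult_mono) auto
  also have "\<dots> = P * norm (f * g * h)"
    by (simp add: P_def norm_mult power3_eq_cube mult_ac)
  finally have *: "u ^ 3 \<le> P * norm (f * g * h)" .
  have "norm (f * g * h) > 0"
    using * assms(1) P by (metis less_le_trans zero_less_mult_pos zero_less_power)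
  then show ?thesis
    unfolding P_def[symmetric] using * assms(1) by (simp add: norm_divide field_simps del: norm_mult)
qed

lemma tau_lattice_eq_range: "tau_lattice \<tau> = range (lattice_point \<tau>)"
  by (auto simp: tau_lattice_def lattice_point_def image_iff)

lemma weierstrass_zeta_tau_lattice:
  assumes "Im \<tau> > 0"
  shows "weierstrass_zeta (tau_lattice \<tau>) z = 1 / z +
    (\<Sum>\<^sub>\<infinity>x\<in>-{(0,0)}. 1 / (z - lattice_point \<tau> x) + 1 / lattice_point \<tau> x + z / lattice_point \<tau> x ^ 2)"
proof -
  have "tau_lattice \<tau> - {0} = lattice_point \<tau> ` (- {(0, 0)})"
    using lattice_point_eq_0_iff[OF assms] by (auto simp: tau_lattice_eq_range)
  then show ?thesis
    using inj_on_subset[OF inj_lattice_point[OF assms] subset_UNIV]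
    by (simp add: weierstrass_zeta_def infsum_reindex o_def)
qed

lemma zeta_summand_eq:
  fixes w z :: complex
  assumes "w \<noteq> 0" "z \<noteq> w"
  shows "1 / (z - w) + 1 / w + z / w ^ 2 = z\<^sup>2 / (w\<^sup>2 * (z - w))"
  using assms by (simp add: field_simps power2_eq_square)

lemma zeta_summand_summable:
  assumes "Im \<tau> > 0" "(s, t) \<notin> \<int> \<times> \<int>"
  defines "z \<equiv> torsion_point (s, t) \<tau>"
  shows "(\<lambda>x. 1 / (z - lattice_point \<tau> x) + 1 / lattice_point \<tau> x + z / lattice_point \<tau> x ^ 2)
    summable_on -{(0,0)}"
proof -
  obtain c where c: "c > 0" "\<And>x. lattice_weight x \<le> c * lattice_distortion \<tau> * norm (z - lattice_point \<tau> x)"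
    unfolding z_def by (rule torsion_point_distance_lower_bound[OF assms(2)], use assms(1) in blast)
  have L: "lattice_distortion \<tau> > 0" using lattice_distortion_ge_1[OF assms(1)] by simp
  show ?thesis
  proof (rule abs_summable_summable, rule summable_on_comparison_test)
    show "(\<lambda>x. (norm z ^ 2 * (2 * 2 * c * lattice_distortion \<tau> ^ 3)) / lattice_weight x ^ 3) summable_on -{(0,0)}"
      by (rule summable_lattice_weight)
  next
    fix x assume x: "x \<in> - {(0::int, 0::int)}"
    define w where "w = lattice_point \<tau> x"
    have w: "w \<noteq> 0" "z \<noteq> w"
      using x assms(1) torsion_point_not_in_lattice[OF assms(1,2)]
      by (auto simp: w_def z_def lattice_point_eq_0_iff)
    have "norm (1 / (w * w * (z - w))) \<le> 2 * 2 * c * lattice_distortion \<tau> ^ 3 / lattice_weight x ^ 3"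
      using x c L lattice_point_lower_bound[OF assms(1), of "fst x" "snd x"]
      by (intro norm_inverse_triple_product_le) (auto simp: w_def lattice_weight_pos)
    from mult_left_mono[OF this, of "norm z ^ 2"]
    show "norm (1 / (z - lattice_point \<tau> x) + 1 / lattice_point \<tau> x + z / lattice_point \<tau> x ^ 2)
       \<le> (norm z ^ 2 * (2 * 2 * c * lattice_distortion \<tau> ^ 3)) / lattice_weight x ^ 3"
      unfolding w_def[symmetric] zeta_summand_eq[OF w]
      by (simp add: norm_divide norm_mult norm_power power2_eq_square)
  qed auto
qed

text \<open>
  The term of \<open>r \<zeta>(z) - \<zeta>(rz)\<close> that belongs to the lattice vector \<open>w\<close>. At \<open>w = 0\<close> the convention
  \<open>1 / 0 = 0\<close> makes it the contribution \<open>r / z - 1 / (rz)\<close> of the two poles at the origin.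
\<close>

definition h_term :: "int \<Rightarrow> complex \<Rightarrow> complex \<Rightarrow> complex" where
  "h_term r z w = of_int r / (z - w) - 1 / (of_int r * z - w) + (of_int r - 1) / w"

lemma h_term_eq:
  assumes "w \<noteq> 0" "z \<noteq> w" "of_int r * z \<noteq> w"
  shows "h_term r z w = of_int (r * (r - 1)) * z\<^sup>2 * (1 / (w * (z - w) * (of_int r * z - w)))"
  using assms by (simp add: h_term_def divide_simps) (simp add: algebra_simps power2_eq_square)

lemma has_sum_diff:
  fixes f g :: "'a \<Rightarrow> 'b :: real_normed_algebra_1"
  assumes "(f has_sum a) A" "(g has_sum b) A"
  shows "((\<lambda>x. f x - g x) has_sum (a - b)) A"
  using has_sum_add[OF assms(1) has_sum_uminusI[OF assms(2)]] by simp

text \<open>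
  In \<open>r \<zeta>(z) - \<zeta>(rz)\<close> the correction terms \<open>rz / \<omega>\<^sup>2\<close> of both series cancel, and the corrections \<open>1 / \<omega>\<close>
  combine to \<open>(r - 1) / \<omega>\<close>.
\<close>

lemma h_fun_has_sum:
  assumes "Im \<tau> > 0" "(s, t) \<notin> \<int> \<times> \<int>" "(of_int r * s, of_int r * t) \<notin> \<int> \<times> \<int>"
  shows "((\<lambda>x. h_term r (torsion_point (s, t) \<tau>) (lattice_point \<tau> x)) has_sum h_fun r (s, t) \<tau>) UNIV"
proof -
  define z where "z = torsion_point (s, t) \<tau>"
  define f where "f z x = 1 / (z - lattice_point \<tau> x) + 1 / lattice_point \<tau> x + z / lattice_point \<tau> x ^ 2" for z x
  have rz: "of_int r * z = torsion_point (of_int r * s, of_int r * t) \<tau>"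
    by (simp add: z_def of_int_times_torsion_point)
  have g: "g_fun p \<tau> = 1 / torsion_point p \<tau> + infsum (f (torsion_point p \<tau>)) (-{(0,0)})" for p
    by (simp add: g_fun_def torsion_point_def f_def[abs_def] case_prod_unfold
        weierstrass_zeta_tau_lattice[OF assms(1)])
  have h_eq: "h_fun r (s, t) \<tau> - h_term r z (lattice_point \<tau> (0, 0)) =
      of_int r * infsum (f z) (-{(0,0)}) - infsum (f (of_int r * z)) (-{(0,0)})"
  proof -
    have "h_fun r (s, t) \<tau> = of_int r * (1 / z + infsum (f z) (-{(0,0)}))
        - (1 / (of_int r * z) + infsum (f (of_int r * z)) (-{(0,0)}))"
      by (simp add: h_fun_def g rz flip: z_def)
    then show ?thesis
      by (simp add: h_term_def lattice_point_def algebra_simps)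
  qed
  have term_eq: "h_term r z (lattice_point \<tau> x) = of_int r * f z x - f (of_int r * z) x" for x
    by (simp add: f_def h_term_def algebra_simps diff_divide_distrib)
  have "((\<lambda>x. h_term r z (lattice_point \<tau> x)) has_sum
      (h_fun r (s, t) \<tau> - h_term r z (lattice_point \<tau> (0,0)))) (-{(0,0)})"
    unfolding h_eq unfolding term_eq
    by (intro has_sum_diff has_sum_cmult_right has_sum_infsum)
       (use zeta_summand_summable[OF assms(1,2)] zeta_summand_summable[OF assms(1,3)] in
        \<open>simp_all add: f_def[abs_def] z_def of_int_times_torsion_point\<close>)
  from has_sum_insert[OF _ this, of "(0,0)"] show ?thesis
    by (simp add: z_def Compl_eq_Diff_UNIV insert_absorb)
qed

text \<open>
  The dependence on \<open>\<tau>\<close> and on the lattice vector is separated. The first makes the series converge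
  locally uniformly and bounds its growth, the second makes it converge.
\<close>

lemma h_term_bound:
  assumes "(s, t) \<notin> \<int> \<times> \<int>" "(of_int r * s, of_int r * t) \<notin> \<int> \<times> \<int>"
  obtains C where "\<And>\<tau> x. Im \<tau> > 0 \<Longrightarrow> norm (h_term r (torsion_point (s, t) \<tau>) (lattice_point \<tau> x))
     \<le> C * (1 + norm \<tau>)\<^sup>2 * lattice_distortion \<tau> ^ 3 / lattice_weight x ^ 3"
proof -
  obtain c where c: "c > 0" "\<And>\<tau> x. Im \<tau> > 0 \<Longrightarrow>
      lattice_weight x \<le> c * lattice_distortion \<tau> * norm (torsion_point (s, t) \<tau> - lattice_point \<tau> x)"
    using torsion_point_distance_lower_bound[OF assms(1)] by blast
  obtain c' where c': "c' > 0" "\<And>\<tau> x. Im \<tau> > 0 \<Longrightarrow>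
      lattice_weight x \<le> c' * lattice_distortion \<tau> * norm (of_int r * torsion_point (s, t) \<tau> - lattice_point \<tau> x)"
    unfolding of_int_times_torsion_point using torsion_point_distance_lower_bound[OF assms(2)] by blast
  \<comment> \<open>The constant \<open>D\<close> comes from the terms with \<open>\<omega> \<noteq> 0\<close>, the constant \<open>E\<close> from the one with \<open>\<omega> = 0\<close>.\<close>
  define B :: real where "B = norm (of_rat s :: complex) + norm (of_rat t :: complex)"
  define D where "D = \<bar>real_of_int (r * (r - 1))\<bar> * B\<^sup>2 * (2 * c * c')"
  define E where "E = (\<bar>real_of_int r\<bar> * c + c')"
  have D: "D \<ge> 0" and E: "E \<ge> 0" using c c' by (auto simp: D_def E_def)
  show thesis
  proof (rule that[of "D + E"])
    fix \<tau> :: complex and x :: "int \<times> int" assume \<tau>: "Im \<tau> > 0"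
    define z where "z = torsion_point (s, t) \<tau>"
    define w where "w = lattice_point \<tau> x"
    define K where "K = lattice_distortion \<tau>"
    have K: "K \<ge> 1" using lattice_distortion_ge_1[OF \<tau>] by (simp add: K_def)
    have ne: "z \<noteq> w" "of_int r * z \<noteq> w"
      using torsion_point_not_in_lattice[OF \<tau> assms(1)] torsion_point_not_in_lattice[OF \<tau> assms(2)]
      by (auto simp: z_def w_def of_int_times_torsion_point)
    have "norm z \<le> norm (of_rat s :: complex) * norm \<tau> + norm (of_rat t :: complex)"
      using norm_triangle_ineq[of "of_rat s * \<tau>" "of_rat t"]
      by (simp add: z_def torsion_point_def norm_mult)
    also have "\<dots> \<le> B * (1 + norm \<tau>)"
      by (simp add: B_def algebra_simps)
    finally have z: "norm z \<le> B * (1 + norm \<tau>)" .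
    show "norm (h_term r (torsion_point (s, t) \<tau>) (lattice_point \<tau> x))
     \<le> (D + E) * (1 + norm \<tau>)\<^sup>2 * lattice_distortion \<tau> ^ 3 / lattice_weight x ^ 3"
    proof (cases "x = (0, 0)")
      case False
      then have w: "w \<noteq> 0" using \<tau> by (simp add: w_def lattice_point_eq_0_iff)
      have "norm (1 / (w * (z - w) * (of_int r * z - w))) \<le> 2 * c * c' * K ^ 3 / lattice_weight x ^ 3"
        using False c c' K \<tau> lattice_point_lower_bound[OF \<tau>, of "fst x" "snd x"]
        by (intro norm_inverse_triple_product_le) (auto simp: w_def z_def K_def lattice_weight_pos)
      then have "norm (of_int (r * (r - 1)) * z\<^sup>2 * (1 / (w * (z - w) * (of_int r * z - w)))) \<le>
         \<bar>of_int (r * (r - 1))\<bar> * (B * (1 + norm \<tau>))\<^sup>2 * (2 * c * c' * K ^ 3 / lattice_weight x ^ 3)"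
        unfolding norm_mult norm_power norm_of_int
        by (intro mult_mono power_mono z) auto
      also have "\<dots> = D * ((1 + norm \<tau>)\<^sup>2 * K ^ 3 / lattice_weight x ^ 3)"
        by (simp add: D_def power_mult_distrib)
      also have "\<dots> \<le> (D + E) * ((1 + norm \<tau>)\<^sup>2 * K ^ 3 / lattice_weight x ^ 3)"
        using E K by (intro mult_right_mono) (auto simp: less_imp_le[OF lattice_weight_pos])
      finally show ?thesis
        using h_term_eq[OF w ne] by (simp add: z_def w_def K_def)
    next
      case True
      have w: "w = 0" and x: "lattice_weight x = 1" by (simp_all add: w_def True lattice_point_def lattice_weight_def)
      have "1 \<le> c * K * norm z" "1 \<le> c' * K * norm (of_int r * z)"
        using c(2)[OF \<tau>, of x] c'(2)[OF \<tau>, of x] x w by (simp_all add: z_def w_def K_def)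
      then have "norm (1 / z) \<le> c * K" "norm (1 / (of_int r * z)) \<le> c' * K"
        using ne w by (simp_all add: norm_divide field_simps)
      then have "norm (of_int r * (1 / z) - 1 / (of_int r * z)) \<le> \<bar>of_int r\<bar> * (c * K) + c' * K"
        by (intro order_trans[OF norm_triangle_ineq4] add_mono) (auto simp: norm_mult intro!: mult_left_mono simp del: times_divide_eq_right)
      also have "\<dots> = E * K" by (simp add: E_def algebra_simps)
      also have "\<dots> \<le> (D + E) * ((1 + norm \<tau>)\<^sup>2 * K ^ 3)"
      proof (rule mult_mono)
        have "1 * K \<le> (1 + norm \<tau>)\<^sup>2 * K ^ 3"
          using K power_increasing[of 1 3 K] by (intro mult_mono) (auto simp: one_le_power)
        then show "K \<le> (1 + norm \<tau>)\<^sup>2 * K ^ 3" by simp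
      qed (use D E K in auto)
      finally show ?thesis
        unfolding z_def[symmetric] w_def[symmetric] K_def[symmetric] x
        by (simp add: w h_term_def)
    qed
  qed
qed

section \<open>Holomorphy and growth\<close>

lemma h_fun_holomorphic:
  assumes "(s, t) \<notin> \<int> \<times> \<int>" "(of_int r * s, of_int r * t) \<notin> \<int> \<times> \<int>"
  shows "h_fun r (s, t) holomorphic_on upper_half_plane"
proof -
  define f where "f x \<tau> = h_term r (torsion_point (s, t) \<tau>) (lattice_point \<tau> x)" for x \<tau>
  obtain C where C: "\<And>\<tau> x. Im \<tau> > 0 \<Longrightarrow> norm (f x \<tau>)
     \<le> C * (1 + norm \<tau>)\<^sup>2 * lattice_distortion \<tau> ^ 3 / lattice_weight x ^ 3"
    using h_term_bound[OF assms] unfolding f_def by blast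
  have f_holo: "f x holomorphic_on upper_half_plane" for x
  proof (cases "x = (0, 0)")
    case True
    have "torsion_point (s, t) \<tau> \<noteq> 0" "of_int r * torsion_point (s, t) \<tau> \<noteq> 0" if "Im \<tau> > 0" for \<tau>
      using torsion_point_not_in_lattice[OF that assms(1), of x] True
         torsion_point_not_in_lattice[OF that assms(2), of x]
      by (auto simp: of_int_times_torsion_point lattice_point_def)
    then show ?thesis
      unfolding f_def[abs_def] h_term_def upper_half_plane_def True
      by (auto simp: lattice_point_def torsion_point_def intro!: holomorphic_intros)
  next
    case False
    obtain m n where x: "x = (m, n)" by (cases x)
    have "torsion_point (s, t) \<tau> - lattice_point \<tau> x \<noteq> 0" "lattice_point \<tau> x \<noteq> 0"
       "of_int r * torsion_point (s, t) \<tau> - lattice_point \<tau> x \<noteq> 0" if "Im \<tau> > 0" for \<tau>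
      using torsion_point_not_in_lattice[OF that assms(1), of x] False
         torsion_point_not_in_lattice[OF that assms(2), of x] lattice_point_eq_0_iff[OF that, of x]
      by (auto simp: of_int_times_torsion_point)
    then show ?thesis
      unfolding f_def[abs_def] h_term_def upper_half_plane_def
      by (auto simp: lattice_point_def torsion_point_def x intro!: holomorphic_intros)
  qed
  have op: "open upper_half_plane"
    unfolding upper_half_plane_def by (rule open_halfspace_Im_gt)
  show ?thesis
  proof (subst holomorphic_on_open[OF op], intro ballI)
    fix \<tau> assume \<tau>: "\<tau> \<in> upper_half_plane"
    then obtain d where d: "d > 0" "cball \<tau> d \<subseteq> upper_half_plane"
      using op by (meson open_contains_cball)
    have "continuous_on (cball \<tau> d) (\<lambda>\<tau>. (1 + norm \<tau>)\<^sup>2 * lattice_distortion \<tau> ^ 3)"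
      unfolding lattice_distortion_def
      using d by (intro continuous_intros) (auto simp: upper_half_plane_def)
    then have "bounded ((\<lambda>\<tau>. (1 + norm \<tau>)\<^sup>2 * lattice_distortion \<tau> ^ 3) ` cball \<tau> d)"
      by (intro compact_imp_bounded compact_continuous_image compact_cball)
    then obtain B where B: "\<And>\<sigma>. \<sigma> \<in> cball \<tau> d \<Longrightarrow> \<bar>(1 + norm \<sigma>)\<^sup>2 * lattice_distortion \<sigma> ^ 3\<bar> \<le> B"
      unfolding bounded_iff by (auto simp del: mem_cball)
    have "uniform_limit (cball \<tau> d) (\<lambda>X \<sigma>. \<Sum>x\<in>X. f x \<sigma>) (h_fun r (s, t)) (finite_subsets_at_top UNIV)"
    proof (rule Weierstrass_m_test_general')
      fix x \<sigma> assume \<sigma>: "\<sigma> \<in> cball \<tau> d"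
      then have Im: "Im \<sigma> > 0" using d by (auto simp: upper_half_plane_def)
      have "norm (f x \<sigma>) \<le> C * ((1 + norm \<sigma>)\<^sup>2 * lattice_distortion \<sigma> ^ 3) / lattice_weight x ^ 3"
        using C[OF Im, of x] by (simp add: mult_ac)
      also have "\<dots> \<le> (\<bar>C\<bar> * B) / lattice_weight x ^ 3"
      proof (rule divide_right_mono)
        have "C * ((1 + norm \<sigma>)\<^sup>2 * lattice_distortion \<sigma> ^ 3) \<le> \<bar>C\<bar> * \<bar>(1 + norm \<sigma>)\<^sup>2 * lattice_distortion \<sigma> ^ 3\<bar>"
          by (metis abs_ge_self abs_mult)
        also have "\<dots> \<le> \<bar>C\<bar> * B" by (intro mult_left_mono B \<sigma>) auto
        finally show "C * ((1 + norm \<sigma>)\<^sup>2 * lattice_distortion \<sigma> ^ 3) \<le> \<bar>C\<bar> * B" .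
      qed (use lattice_weight_pos[of x] in auto)
      finally show "norm (f x \<sigma>) \<le> (\<bar>C\<bar> * B) / lattice_weight x ^ 3" .
    next
      show "((\<lambda>x. f x \<sigma>) has_sum h_fun r (s, t) \<sigma>) UNIV" if "\<sigma> \<in> cball \<tau> d" for \<sigma>
        using h_fun_has_sum[OF _ assms, of \<sigma>] that d
        by (auto simp: f_def[abs_def] upper_half_plane_def)
    qed (rule summable_lattice_weight)
    then have "h_fun r (s, t) holomorphic_on ball \<tau> d"
    proof (rule holomorphic_uniform_limit[rotated])
      show "\<forall>\<^sub>F X in finite_subsets_at_top UNIV. continuous_on (cball \<tau> d) (\<lambda>\<sigma>. \<Sum>x\<in>X. f x \<sigma>) \<and>
         (\<lambda>\<sigma>. \<Sum>x\<in>X. f x \<sigma>) holomorphic_on ball \<tau> d"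
        using d order.trans[OF ball_subset_cball d(2)]
        by (intro always_eventually allI conjI holomorphic_on_imp_continuous_on holomorphic_on_sum)
           (auto intro: holomorphic_on_subset[OF f_holo])
    qed auto
    then show "\<exists>f'. (h_fun r (s, t) has_field_derivative f') (at \<tau>)"
      using d(1) by (auto simp: holomorphic_on_open)
  qed
qed

lemma h_fun_growth:
  assumes "(s, t) \<notin> \<int> \<times> \<int>" "(of_int r * s, of_int r * t) \<notin> \<int> \<times> \<int>"
  obtains C where "\<And>\<tau>. Im \<tau> > 0 \<Longrightarrow> norm (h_fun r (s, t) \<tau>) \<le> C * (1 + norm \<tau>)\<^sup>2 * lattice_distortion \<tau> ^ 3"
proof -
  obtain C where C: "\<And>\<tau> x. Im \<tau> > 0 \<Longrightarrow> norm (h_term r (torsion_point (s, t) \<tau>) (lattice_point \<tau> x))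
     \<le> C * (1 + norm \<tau>)\<^sup>2 * lattice_distortion \<tau> ^ 3 / lattice_weight x ^ 3"
    using h_term_bound[OF assms] by blast
  define S where "S = infsum (\<lambda>x. 1 / lattice_weight x ^ 3) UNIV"
  show thesis
  proof (rule that[of "C * S"])
    fix \<tau> :: complex assume \<tau>: "Im \<tau> > 0"
    have "((\<lambda>x. 1 / lattice_weight x ^ 3) has_sum S) UNIV"
      unfolding S_def by (intro has_sum_infsum summable_lattice_weight)
    from has_sum_cmult_right[OF this, of "C * (1 + norm \<tau>)\<^sup>2 * lattice_distortion \<tau> ^ 3"]
    have "((\<lambda>x. C * (1 + norm \<tau>)\<^sup>2 * lattice_distortion \<tau> ^ 3 / lattice_weight x ^ 3) has_sum
        (C * (1 + norm \<tau>)\<^sup>2 * lattice_distortion \<tau> ^ 3) * S) UNIV" by simp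
    from norm_infsum_le[OF h_fun_has_sum[OF \<tau> assms] this C[OF \<tau>]]
    show "norm (h_fun r (s, t) \<tau>) \<le> C * S * (1 + norm \<tau>)\<^sup>2 * lattice_distortion \<tau> ^ 3"
      by (simp add: mult_ac)
  qed
qed

section \<open>Invariance under integral translations\<close>

text \<open>
  The sum telescopes to finitely many values of \<open>v\<close> near \<open>-N\<close> and near \<open>N\<close>. It will be
  used for reciprocals \<open>v\<close>, whose own series over a line diverges; so only partial sums are compared.
\<close>

lemma telescoping_int_sum_tendsto:
  fixes v :: "int \<Rightarrow> 'a :: real_normed_vector"
  assumes top: "\<And>j. (\<lambda>N. v (int N + j)) \<longlonglongrightarrow> 0" and bot: "\<And>j. (\<lambda>N. v (- int N + j)) \<longlonglongrightarrow> 0"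
  shows "(\<lambda>N. \<Sum>n\<in>{- int N..int N}. v (n - k) - v n) \<longlonglongrightarrow> 0"
proof -
  have step: "(\<Sum>n\<in>{- int N..int N}. v (n - (k + 1)) - v (n - k)) = v (- int N + (- k - 1)) - v (int N + (- k))" for k N
  proof (induction N)
    case (Suc N)
    have "{- int (Suc N)..int (Suc N)} = insert (- int (Suc N)) (insert (int (Suc N)) {- int N..int N})"
      by auto
    moreover have "v (- k - (1 + int N)) = v (- 1 - (k + int N))" by (rule arg_cong[of _ _ v]) simp
    ultimately show ?case using Suc by (simp add: algebra_simps)
  next
    case 0
    have "v (- 1 - k) = v (- k - 1)" by (rule arg_cong[of _ _ v]) simp
    then show ?case by (simp add: algebra_simps)
  qed
  have *: "(\<lambda>N. \<Sum>n\<in>{- int N..int N}. v (n - (k + 1)) - v (n - k)) \<longlonglongrightarrow> 0" for k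
    unfolding step using tendsto_diff[OF bot[of "- k - 1"] top[of "- k"]] by (simp only: diff_zero)
  show ?thesis
  proof (induction k rule: int_induct[where k = 0])
    case (step1 i)
    from tendsto_add[OF step1(2) *[of i]] show ?case by (simp add: sum.distrib[symmetric])
  next
    case (step2 i)
    from tendsto_diff[OF step2(2) *[of "i - 1"]] show ?case by (simp add: sum_subtractf[symmetric])
  qed simp
qed

lemma has_sum_int_imp_symmetric_limit:
  assumes "(f has_sum S) (UNIV :: int set)"
  shows "(\<lambda>N. \<Sum>n\<in>{- int N..int N}. f n) \<longlonglongrightarrow> S"
proof -
  have "filterlim (\<lambda>N. {- int N..int N}) (finite_subsets_at_top UNIV) sequentially"
    unfolding filterlim_finite_subsets_at_top
  proof safe
    fix X :: "int set" assume X: "finite X"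
    define M where "M = nat (Max (insert 0 (abs ` X)))"
    have "\<bar>x\<bar> \<le> int M" if "x \<in> X" for x
      using X that unfolding M_def by (simp add: le_nat_iff Max_ge_iff)
    then show "\<forall>\<^sub>F N in sequentially. finite {- int N..int N} \<and> X \<subseteq> {- int N..int N} \<and> {- int N..int N} \<subseteq> UNIV"
      by (intro eventually_sequentiallyI[of M]) force
  qed
  from filterlim_compose[OF assms[unfolded has_sum_def] this] show ?thesis .
qed

lemma infsum_eq_0_if_line_sums_tendsto_0:
  fixes f :: "int \<times> int \<Rightarrow> 'a :: banach"
  assumes "f summable_on UNIV"
    and "\<And>m. (\<lambda>N. \<Sum>n\<in>{- int N..int N}. f (m, n)) \<longlonglongrightarrow> 0"
  shows "infsum f UNIV = 0"
proof -
  have sm: "(\<lambda>(m, n). f (m, n)) summable_on (SIGMA m:UNIV. UNIV)"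
    using assms(1) by simp
  have "(\<lambda>n. f (m, n)) summable_on UNIV" for m
  proof -
    have "f summable_on range (Pair m)"
      by (rule summable_on_subset_banach[OF assms(1)]) simp
    then show ?thesis
      by (subst (asm) summable_on_reindex) (auto simp: inj_def o_def)
  qed
  then have "infsum (\<lambda>n. f (m, n)) UNIV = 0" for m
    using LIMSEQ_unique[OF has_sum_int_imp_symmetric_limit assms(2)] has_sum_infsum by blast
  then show ?thesis
    using infsum_Sigma'_banach[OF sm] by simp
qed

lemma reciprocal_tendsto_0:
  fixes a b :: complex
  assumes "b \<noteq> 0"
  shows "(\<lambda>N. 1 / (a + of_nat N * b)) \<longlonglongrightarrow> 0"
proof -
  have "filterlim (\<lambda>N. b * of_nat N) at_infinity sequentially"
    by (rule tendsto_mult_filterlim_at_infinity[OF tendsto_const assms tendsto_of_nat])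
  then have "filterlim (\<lambda>N. a + b * of_nat N) at_infinity sequentially"
    by (rule tendsto_add_filterlim_at_infinity[OF tendsto_const])
  then show ?thesis
    by (intro tendsto_divide_0[OF tendsto_const]) (simp add: mult.commute)
qed

lemma telescoping_reciprocals_tendsto:
  fixes a b :: complex
  assumes "b \<noteq> 0"
  defines "v \<equiv> \<lambda>n::int. 1 / (a - of_int n * b)"
  shows "(\<lambda>N. \<Sum>n\<in>{- int N..int N}. v (n - k) - v n) \<longlonglongrightarrow> 0"
proof (rule telescoping_int_sum_tendsto)
  fix j :: int
  show "(\<lambda>N. v (int N + j)) \<longlonglongrightarrow> 0"
    using reciprocal_tendsto_0[of "-b" "a - of_int j * b"] assms(1) by (simp add: v_def algebra_simps)
  show "(\<lambda>N. v (- int N + j)) \<longlonglongrightarrow> 0"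
    using reciprocal_tendsto_0[of b "a - of_int j * b"] assms(1) by (simp add: v_def algebra_simps)
qed

text \<open>
  Moving \<open>z\<close> by \<open>k b\<close> moves \<open>rz\<close> by \<open>r k b\<close>, and the term \<open>(r - 1) / \<omega>\<close> does not change. On
  each line in direction \<open>b\<close> the difference of the two sums is therefore a combination of two
  telescoping series of reciprocals, one with step \<open>k\<close> and one with step \<open>rk\<close>.
\<close>

lemma h_sum_lattice_shift:
  fixes a b z :: complex
  defines "u \<equiv> \<lambda>(m::int, n::int). of_int m * a + of_int n * b"
  assumes b: "b \<noteq> 0"
    and S: "((\<lambda>x. h_term r z (u x)) has_sum S) UNIV"
    and S': "((\<lambda>x. h_term r (z + of_int k * b) (u x)) has_sum S') UNIV"
  shows "S' = S"
proof -
  let ?d = "\<lambda>x. h_term r (z + of_int k * b) (u x) - h_term r z (u x)"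
  have d: "(?d has_sum (S' - S)) UNIV"
    by (rule has_sum_diff[OF S' S])
  have "infsum ?d UNIV = 0"
  proof (rule infsum_eq_0_if_line_sums_tendsto_0)
    show "?d summable_on UNIV" using d by (rule has_sum_imp_summable)
    fix m :: int
    define v1 where "v1 n = 1 / ((z - of_int m * a) - of_int n * b)" for n :: int
    define v2 where "v2 n = 1 / ((of_int r * z - of_int m * a) - of_int n * b)" for n :: int
    have "(\<lambda>N. of_int r * (\<Sum>n\<in>{- int N..int N}. v1 (n - k) - v1 n)
        - (\<Sum>n\<in>{- int N..int N}. v2 (n - r * k) - v2 n)) \<longlonglongrightarrow> of_int r * 0 - 0"
      unfolding v1_def v2_def
      by (intro tendsto_diff tendsto_mult_left telescoping_reciprocals_tendsto b)
    moreover have "?d (m, n) = of_int r * (v1 (n - k) - v1 n) - (v2 (n - r * k) - v2 n)" for n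
      unfolding h_term_def u_def v1_def v2_def by (simp add: algebra_simps)
    ultimately show "(\<lambda>N. \<Sum>n\<in>{- int N..int N}. ?d (m, n)) \<longlonglongrightarrow> 0"
      by (simp add: sum_subtractf sum_distrib_left right_diff_distrib)
  qed
  then show ?thesis using d by (simp add: infsumI)
qed

lemma not_in_Ints_times_shift:
  fixes s t :: rat
  assumes "(s, t) \<notin> \<int> \<times> \<int>" "i \<in> \<int>" "j \<in> \<int>"
  shows "(s + i, t + j) \<notin> \<int> \<times> \<int>"
  using assms Ints_diff[of "s + i" i] Ints_diff[of "t + j" j] by auto

lemma h_fun_shift_int:
  fixes s t :: rat and i j r :: int
  assumes \<tau>: "Im \<tau> > 0" and st: "(s, t) \<notin> \<int> \<times> \<int>" "(of_int r * s, of_int r * t) \<notin> \<int> \<times> \<int>"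
  shows "h_fun r (s + of_int i, t + of_int j) \<tau> = h_fun r (s, t) \<tau>"
proof -
  have st': "(s, t + of_int j) \<notin> \<int> \<times> \<int>" "(of_int r * s, of_int r * (t + of_int j)) \<notin> \<int> \<times> \<int>"
     "(s + of_int i, t + of_int j) \<notin> \<int> \<times> \<int>" "(of_int r * (s + of_int i), of_int r * (t + of_int j)) \<notin> \<int> \<times> \<int>"
    using not_in_Ints_times_shift[OF st(1), of 0 "of_int j"] not_in_Ints_times_shift[OF st(1), of "of_int i" "of_int j"]
      not_in_Ints_times_shift[OF st(2), of 0 "of_int (r * j)"]
      not_in_Ints_times_shift[OF st(2), of "of_int (r * i)" "of_int (r * j)"]
    by (simp_all add: algebra_simps)
  have "h_fun r (s, t + of_int j) \<tau> = h_fun r (s, t) \<tau>"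
  proof (rule h_sum_lattice_shift[of 1 r "torsion_point (s, t) \<tau>" \<tau> _ j])
    show "((\<lambda>x. h_term r (torsion_point (s, t) \<tau>) (case x of (m, n) \<Rightarrow> of_int m * \<tau> + of_int n * 1))
        has_sum h_fun r (s, t) \<tau>) UNIV"
      using h_fun_has_sum[OF \<tau> st] by (simp add: lattice_point_def)
    show "((\<lambda>x. h_term r (torsion_point (s, t) \<tau> + of_int j * 1) (case x of (m, n) \<Rightarrow> of_int m * \<tau> + of_int n * 1))
        has_sum h_fun r (s, t + of_int j) \<tau>) UNIV"
      using h_fun_has_sum[OF \<tau> st'(1,2)] by (simp add: lattice_point_def torsion_point_def of_rat_add add.assoc)
  qed simp
  moreover have "h_fun r (s + of_int i, t + of_int j) \<tau> = h_fun r (s, t + of_int j) \<tau>"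
  proof (rule h_sum_lattice_shift[of \<tau> r "torsion_point (s, t + of_int j) \<tau>" 1 _ i])
    \<comment> \<open>The two basis vectors change roles, so that the lines run in direction \<open>\<tau>\<close>.\<close>
    have swap: "((\<lambda>x. h_term r z (case x of (m, n) \<Rightarrow> of_int m * 1 + of_int n * \<tau>)) has_sum S) UNIV \<longleftrightarrow>
      ((\<lambda>x. h_term r z (lattice_point \<tau> x)) has_sum S) UNIV" for z S
      using has_sum_reindex_bij_betw[OF bij_swap, of "\<lambda>x. h_term r z (lattice_point \<tau> x)" S]
      by (simp add: lattice_point_def case_prod_unfold add.commute)
    show "((\<lambda>x. h_term r (torsion_point (s, t + of_int j) \<tau>) (case x of (m, n) \<Rightarrow> of_int m * 1 + of_int n * \<tau>))
        has_sum h_fun r (s, t + of_int j) \<tau>) UNIV"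
      unfolding swap by (rule h_fun_has_sum[OF \<tau> st'(1,2)])
    have "torsion_point (s, t + of_int j) \<tau> + of_int i * \<tau> = torsion_point (s + of_int i, t + of_int j) \<tau>"
      by (simp add: torsion_point_def of_rat_add algebra_simps)
    then show "((\<lambda>x. h_term r (torsion_point (s, t + of_int j) \<tau> + of_int i * \<tau>) (case x of (m, n) \<Rightarrow> of_int m * 1 + of_int n * \<tau>))
        has_sum h_fun r (s + of_int i, t + of_int j) \<tau>) UNIV"
      unfolding swap using h_fun_has_sum[OF \<tau> st'(3,4)] by simp
    show "\<tau> \<noteq> 0" using \<tau> by auto
  qed
  ultimately show ?thesis by simp
qed

section \<open>The action of the modular group\<close>

lemma weierstrass_zeta_scale:
  assumes "c \<noteq> 0"
  shows "weierstrass_zeta ((\<lambda>w. c * w) ` \<Omega>) (c * z) = weierstrass_zeta \<Omega> z / c"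
proof -
  have img: "(\<lambda>w. c * w) ` \<Omega> - {0} = (\<lambda>w. c * w) ` (\<Omega> - {0})"
    using assms by auto
  have inj: "inj_on (\<lambda>w. c * w) (\<Omega> - {0})"
    using assms by (simp add: inj_on_def)
  have summand: "1 / (c * z - c * w) + 1 / (c * w) + c * z / (c * w) ^ 2
      = (1 / c) * (1 / (z - w) + 1 / w + z / w ^ 2)" for w
    using assms by (simp add: power2_eq_square distrib_left flip: right_diff_distrib)
  show ?thesis
    unfolding weierstrass_zeta_def img infsum_reindex[OF inj] o_def summand infsum_cmult_right'
    by (simp add: add_divide_distrib mult.commute)
qed

lemma clear_denominator:
  fixes J :: complex
  assumes "J \<noteq> 0"
  shows "J * (x * (u / J) + y) = x * u + y * J"
  using assms by (simp add: field_simps)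

lemma SL2Z_det:
  "A \<in> SL2Z \<Longrightarrow> A $ 1 $ 1 * A $ 2 $ 2 - A $ 1 $ 2 * A $ 2 $ 1 = 1"
  by (simp add: SL2Z_def det_2)

lemma automorphy_factor_nonzero:
  fixes c d :: int
  assumes "Im \<tau> > 0" "(c, d) \<noteq> (0, 0)"
  shows "of_int c * \<tau> + of_int d \<noteq> 0"
  using lattice_point_eq_0_iff[OF assms(1), of "(c, d)"] assms(2) by (simp add: lattice_point_def)

text \<open>
  The vectors \<open>a\<tau> + b\<close> and \<open>c\<tau> + d\<close> form another basis of the same lattice, because the determinant is one.
\<close>

lemma tau_lattice_moebius:
  fixes a b c d :: int
  assumes det: "a * d - b * c = 1" and J: "of_int c * \<tau> + of_int d \<noteq> 0"
  shows "(\<lambda>w. (of_int c * \<tau> + of_int d) * w) `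
      tau_lattice ((of_int a * \<tau> + of_int b) / (of_int c * \<tau> + of_int d)) = tau_lattice \<tau>"
proof -
  let ?J = "of_int c * \<tau> + of_int d"
  have eq: "?J * (of_int m * ((of_int a * \<tau> + of_int b) / ?J) + of_int n)
       = of_int (m * a + n * c) * \<tau> + of_int (m * b + n * d)" for m n
    unfolding clear_denominator[OF J] by (simp add: algebra_simps)
  show ?thesis
  proof (intro equalityI subsetI)
    fix x assume "x \<in> (\<lambda>w. ?J * w) ` tau_lattice ((of_int a * \<tau> + of_int b) / ?J)"
    then obtain m n :: int where "x = ?J * (of_int m * ((of_int a * \<tau> + of_int b) / ?J) + of_int n)"
      by (auto simp: tau_lattice_def)
    then show "x \<in> tau_lattice \<tau>"
      unfolding eq tau_lattice_def by blast
  next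
    fix x assume "x \<in> tau_lattice \<tau>"
    then obtain m n :: int where x: "x = of_int m * \<tau> + of_int n"
      by (auto simp: tau_lattice_def)
    \<comment> \<open>The new coordinates are those of \<open>(m, n)\<close> times the inverse matrix.\<close>
    have "(m * d - n * c) * a + (n * a - m * b) * c = m * (a * d - b * c)"
         "(m * d - n * c) * b + (n * a - m * b) * d = n * (a * d - b * c)"
      by (simp_all add: algebra_simps)
    then have "x = ?J * (of_int (m * d - n * c) * ((of_int a * \<tau> + of_int b) / ?J) + of_int (n * a - m * b))"
      unfolding eq x det by simp
    then show "x \<in> (\<lambda>w. ?J * w) ` tau_lattice ((of_int a * \<tau> + of_int b) / ?J)"
      unfolding tau_lattice_def by blast
  qed
qed

lemma slash_g_fun:
  assumes A: "A \<in> SL2Z" and \<tau>: "Im \<tau> > 0"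
  shows "slash 1 (g_fun p) A \<tau> = g_fun (row_act p A) \<tau>"
proof -
  obtain s t where p: "p = (s, t)" by (cases p)
  define a b c d where "a = A $ 1 $ 1" and "b = A $ 1 $ 2" and "c = A $ 2 $ 1" and "d = A $ 2 $ 2"
  note abcd = a_def b_def c_def d_def
  have det: "a * d - b * c = 1" using SL2Z_det[OF A] by (simp add: abcd)
  define J where "J = of_int c * \<tau> + of_int d"
  define \<sigma> where "\<sigma> = (of_int a * \<tau> + of_int b) / J"
  have J: "J \<noteq> 0"
    unfolding J_def by (rule automorphy_factor_nonzero[OF \<tau>]) (use det in auto)
  have z: "J * (of_rat s * \<sigma> + of_rat t) =
      of_rat (s * of_int a + t * of_int c) * \<tau> + of_rat (s * of_int b + t * of_int d)"
  proof -
    have "J * (of_rat s * \<sigma> + of_rat t) = of_rat s * (of_int a * \<tau> + of_int b) + of_rat t * J"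
      unfolding \<sigma>_def by (rule clear_denominator[OF J])
    then show ?thesis by (simp add: J_def of_rat_add of_rat_mult algebra_simps)
  qed
  have "g_fun (row_act p A) \<tau> =
     weierstrass_zeta ((\<lambda>w. J * w) ` tau_lattice \<sigma>) (J * (of_rat s * \<sigma> + of_rat t))"
    using tau_lattice_moebius[OF det, of \<tau>] J
    unfolding z by (simp add: g_fun_def row_act_def p abcd \<sigma>_def J_def)
  also have "\<dots> = g_fun p \<sigma> / J"
    by (subst weierstrass_zeta_scale[OF J]) (simp add: g_fun_def p)
  finally show ?thesis
    by (simp add: slash_def Let_def power_int_minus divide_inverse mult.commute
         flip: abcd, simp add: \<sigma>_def J_def divide_inverse mult.commute)
qed

lemma slash_h_fun:
  assumes A: "A \<in> SL2Z" and \<tau>: "Im \<tau> > 0"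
  shows "slash 1 (h_fun r p) A \<tau> = h_fun r (row_act p A) \<tau>"
proof -
  obtain s t where p: "p = (s, t)" by (cases p)
  have r: "row_act (of_int r * s, of_int r * t) A =
      (of_int r * fst (row_act p A), of_int r * snd (row_act p A))"
    by (simp add: row_act_def p algebra_simps)
  have "slash 1 (h_fun r p) A \<tau> = of_int r * slash 1 (g_fun p) A \<tau>
      - slash 1 (g_fun (of_int r * s, of_int r * t)) A \<tau>"
    by (simp add: slash_def Let_def h_fun_def p algebra_simps)
  also have "\<dots> = h_fun r (row_act p A) \<tau>"
    unfolding slash_g_fun[OF A \<tau>] r by (simp add: h_fun_def case_prod_unfold)
  finally show ?thesis .
qed

text \<open>
  The inverse of an integral matrix of determinant one is integral as well.
\<close>

lemma row_act_in_Ints_iff: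
  assumes "A \<in> SL2Z"
  shows "row_act p A \<in> \<int> \<times> \<int> \<longleftrightarrow> p \<in> \<int> \<times> \<int>"
proof -
  obtain s t where p: "p = (s, t)" by (cases p)
  define a b c d :: rat where "a = of_int (A $ 1 $ 1)" and "b = of_int (A $ 1 $ 2)"
    and "c = of_int (A $ 2 $ 1)" and "d = of_int (A $ 2 $ 2)"
  note abcd = a_def b_def c_def d_def
  have Ints: "a \<in> \<int>" "b \<in> \<int>" "c \<in> \<int>" "d \<in> \<int>" by (simp_all add: abcd)
  have "of_int (A $ 1 $ 1 * A $ 2 $ 2 - A $ 1 $ 2 * A $ 2 $ 1) = (1 :: rat)"
    by (simp only: SL2Z_det[OF assms] of_int_1)
  then have det: "a * d - b * c = 1" by (simp add: abcd)
  \<comment> \<open>Cramer's rule expresses \<open>p\<close> by its image.\<close>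
  have "s = s * (a * d - b * c)" "t = t * (a * d - b * c)" unfolding det by simp_all
  then have st: "s = (s * a + t * c) * d - (s * b + t * d) * c" "t = (s * b + t * d) * a - (s * a + t * c) * b"
    by (simp_all add: algebra_simps)
  have act: "row_act p A = (s * a + t * c, s * b + t * d)" by (simp add: row_act_def p abcd)
  show ?thesis
  proof
    assume "row_act p A \<in> \<int> \<times> \<int>"
    then have *: "s * a + t * c \<in> \<int>" "s * b + t * d \<in> \<int>" by (simp_all add: act)
    have "s \<in> \<int>" by (subst st(1)) (intro Ints_diff Ints_mult * Ints)
    moreover have "t \<in> \<int>" by (subst st(2)) (intro Ints_diff Ints_mult * Ints)
    ultimately show "p \<in> \<int> \<times> \<int>" by (simp add: p)
  next
    assume "p \<in> \<int> \<times> \<int>"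
    then show "row_act p A \<in> \<int> \<times> \<int>"
      unfolding act by (auto simp: p intro!: Ints_add Ints_mult Ints)
  qed
qed

section \<open>Boundedness at the cusps\<close>

lemma periodic_of_int_multiple:
  fixes f :: "complex \<Rightarrow> complex"
  assumes "\<And>\<tau>. Im \<tau> > 0 \<Longrightarrow> f (\<tau> + of_real w) = f \<tau>" "Im \<tau> > 0"
  shows "f (\<tau> + of_int k * of_real w) = f \<tau>"
proof (induction k rule: int_induct[where k = 0])
  case (step1 i)
  then show ?case using assms(1)[of "\<tau> + of_int i * of_real w"] assms(2) by (simp add: algebra_simps)
next
  case (step2 i)
  then show ?case using assms(1)[of "\<tau> + of_int (i - 1) * of_real w"] assms(2) by (simp add: algebra_simps)
qed simp

text \<open>
  By periodicity \<open>f(\<tau>) = F(q)\<close> with \<open>q = exp(2\<pi>\<i>\<tau> / w)\<close> and \<open>F\<close> holomorphic on the punctured unit disc.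
  Since \<open>Im \<tau>\<close> is a multiple of \<open>- ln \<bar>q\<bar>\<close>, the growth condition forces \<open>q F(q)\<close> to tend to \<open>0\<close>. So \<open>F\<close>
  extends over \<open>q = 0\<close>, and it is bounded on every smaller closed disc by compactness.
\<close>

lemma periodic_polynomial_growth_imp_bounded:
  fixes f :: "complex \<Rightarrow> complex" and w :: real
  assumes holo: "f holomorphic_on {\<tau>. Im \<tau> > 0}"
    and w: "w > 0" and per: "\<And>\<tau>. Im \<tau> > 0 \<Longrightarrow> f (\<tau> + of_real w) = f \<tau>"
    and growth: "\<And>\<tau>. Im \<tau> \<ge> 1 \<Longrightarrow> \<bar>Re \<tau>\<bar> \<le> w \<Longrightarrow> norm (f \<tau>) \<le> C * (Im \<tau>) ^ k"
  shows "bounded (f ` {\<tau>. Im \<tau> > 1})"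
proof -
  define c :: complex where "c = of_real w / (2 * of_real pi * \<i>)"
  have c: "c \<noteq> 0" "c * (2 * of_real pi * \<i>) = of_real w" using w by (simp_all add: c_def)
  have Re_Im_c: "Re (c * l) = w / (2 * pi) * Im l" "Im (c * l) = - w / (2 * pi) * Re l" for l
    by (simp_all add: c_def Re_divide Im_divide power2_eq_square field_simps)
  define F where "F q = f (c * Ln q)" for q
  define D where "D = ball (0::complex) 1 - {0}"
  have pos: "Im (c * Ln q) > 0" if "q \<in> D" for q
    using that w unfolding Re_Im_c by (auto simp: D_def mult_pos_neg divide_neg_pos)
  have f_eq: "f (c * l) = F q" if "exp l = q" "q \<in> D" for l q
  proof -
    have "q \<noteq> 0" using that by auto
    then have "exp l = exp (Ln q)" using that by simp
    then obtain j :: int where "l = Ln q + of_int (2 * j) * pi * \<i>"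
      unfolding exp_eq by auto
    then have "c * l = c * Ln q + of_int j * of_real w"
      unfolding c(2)[symmetric] by (simp add: algebra_simps)
    then show ?thesis
      using periodic_of_int_multiple[of f w, OF per pos[OF that(2)], of j] by (simp add: F_def)
  qed
  have "F holomorphic_on D"
  proof -
    \<comment> \<open>The logarithms with cuts along the negative and along the positive real axis give the same \<open>F\<close>,
        and their domains cover the punctured disc.\<close>
    have 1: "F holomorphic_on (D - \<real>\<^sub>\<le>\<^sub>0)"
      unfolding F_def
      by (rule holomorphic_on_compose_gen[unfolded o_def, OF _ holo])
         (use pos in \<open>auto simp: D_def intro!: holomorphic_intros\<close>)
    have 2: "F holomorphic_on (D - \<real>\<^sub>\<ge>\<^sub>0)"
    proof (rule holomorphic_transform)
      show "(\<lambda>q. f (c * (Ln (- q) + pi * \<i>))) holomorphic_on (D - \<real>\<^sub>\<ge>\<^sub>0)"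
      proof (rule holomorphic_on_compose_gen[unfolded o_def, OF _ holo])
        show "(\<lambda>q. c * (Ln (- q) + pi * \<i>)) holomorphic_on (D - \<real>\<^sub>\<ge>\<^sub>0)"
          by (auto simp: D_def complex_nonneg_Reals_iff complex_nonpos_Reals_iff intro!: holomorphic_intros)
        show "(\<lambda>q. c * (Ln (- q) + pi * \<i>)) ` (D - \<real>\<^sub>\<ge>\<^sub>0) \<subseteq> {\<tau>. Im \<tau> > 0}"
          using w unfolding image_subset_iff mem_Collect_eq Re_Im_c by (auto simp: D_def mult_pos_neg divide_neg_pos)
      qed
      show "f (c * (Ln (- q) + pi * \<i>)) = F q" if "q \<in> D - \<real>\<^sub>\<ge>\<^sub>0" for q
        using that by (intro f_eq) (auto simp: exp_add D_def)
    qed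
    have "F holomorphic_on ((D - \<real>\<^sub>\<le>\<^sub>0) \<union> (D - \<real>\<^sub>\<ge>\<^sub>0))"
      by (rule holomorphic_on_Un[OF 1 2])
         (auto simp: D_def intro!: open_Diff closed_nonneg_Reals_complex closed_nonpos_Reals_complex)
    also have "(D - \<real>\<^sub>\<le>\<^sub>0) \<union> (D - \<real>\<^sub>\<ge>\<^sub>0) = D"
      by (auto simp: D_def complex_nonneg_Reals_iff complex_nonpos_Reals_iff complex_eq_iff)
    finally show ?thesis .
  qed
  moreover have "((\<lambda>q. (q - 0) * F q) \<longlongrightarrow> 0) (at 0)"
  proof (rule Lim_null_comparison)
    define g where "g x = x * (C * (w / (2 * pi) * (- ln x)) ^ k)" for x
    have "filterlim (\<lambda>x::real. - ln x) at_top (at_right 0)"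
      using ln_at_0 by (simp add: filterlim_uminus_at_bot)
    from filterlim_compose[OF tendsto_power_div_exp_0 this, of k]
    have "((\<lambda>x::real. x * (- ln x) ^ k) \<longlongrightarrow> 0) (at_right 0)"
      by (rule Lim_transform_eventually)
         (auto simp: eventually_at_filter exp_minus field_simps)
    then have "((\<lambda>x::real. C * (w / (2 * pi)) ^ k * (x * (- ln x) ^ k)) \<longlongrightarrow> C * (w / (2 * pi)) ^ k * 0) (at_right 0)"
      by (intro tendsto_mult_left)
    then have "(g \<longlongrightarrow> 0) (at_right 0)"
      unfolding g_def power_mult_distrib by (simp add: mult_ac)
    moreover have "filterlim (norm :: complex \<Rightarrow> real) (at_right 0) (at 0)"
      by (auto simp: filterlim_at eventually_at_filter intro!: tendsto_eq_intros)
    ultimately show "((\<lambda>q::complex. g (norm q)) \<longlongrightarrow> 0) (at 0)"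
      by (rule filterlim_compose)
    \<comment> \<open>This radius corresponds to the line \<open>Im \<tau> = 1\<close>.\<close>
    have "\<forall>\<^sub>F q::complex in at 0. q \<in> ball 0 (exp (- 2 * pi / w)) - {0}"
      by (intro eventually_at_in_open) auto
    then show "\<forall>\<^sub>F q in at 0. norm ((q - 0) * F q) \<le> g (norm q)"
    proof eventually_elim
      case (elim q)
      then have q: "q \<noteq> 0" "norm q < exp (- 2 * pi / w)" by auto
      then have "ln (norm q) < - 2 * pi / w"
        by (metis exp_less_cancel_iff exp_ln zero_less_norm_iff)
      then have "Im (c * Ln q) \<ge> 1"
        using q w unfolding Re_Im_c by (simp add: field_simps)
      moreover have "\<bar>Re (c * Ln q)\<bar> \<le> w"
      proof -
        have "\<bar>Im (Ln q)\<bar> \<le> pi"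
          using Im_Ln_le_pi[OF q(1)] mpi_less_Im_Ln[OF q(1)] by auto
        then show ?thesis
          using w pi_gt_zero unfolding Re_Im_c by (simp add: abs_mult field_simps)
      qed
      ultimately have "norm (F q) \<le> C * Im (c * Ln q) ^ k"
        unfolding F_def by (rule growth)
      also have "Im (c * Ln q) = w / (2 * pi) * (- ln (norm q))"
        using q unfolding Re_Im_c by simp
      finally show ?case
        by (simp add: g_def norm_mult mult_left_mono)
    qed
  qed
  ultimately obtain G where G: "G holomorphic_on ball 0 1" "\<And>q. q \<in> D \<Longrightarrow> G q = F q"
    using holomorphic_on_extend_lim[of F "ball 0 1" 0] unfolding D_def by auto
  define \<rho> where "\<rho> = exp (- 2 * pi / w)"
  have small: "\<rho> < 1" using w by (simp add: \<rho>_def)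
  then have "cball 0 \<rho> \<subseteq> ball (0::complex) 1" by auto
  then have "bounded (G ` cball 0 \<rho>)"
    by (intro compact_imp_bounded compact_continuous_image
         holomorphic_on_imp_continuous_on[OF holomorphic_on_subset[OF G(1)]] compact_cball)
  moreover have "f ` {\<tau>. Im \<tau> > 1} \<subseteq> G ` cball 0 \<rho>"
  proof safe
    fix \<tau> :: complex assume \<tau>: "Im \<tau> > 1"
    define q where "q = exp (\<tau> / c)"
    have Re: "Re (\<tau> / c) = - 2 * pi / w * Im \<tau>"
      using w by (simp add: c_def Re_divide power2_eq_square field_simps)
    have "q \<noteq> 0" by (simp add: q_def)
    moreover have "norm q \<le> \<rho>"
      using \<tau> w by (simp add: q_def \<rho>_def Re field_simps)
    ultimately have q: "q \<in> D" "q \<in> cball 0 \<rho>"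
      using small by (auto simp: D_def)
    have "f \<tau> = f (c * (\<tau> / c))" using c by simp
    also have "\<dots> = F q" by (rule f_eq) (use q in \<open>auto simp: q_def\<close>)
    also have "\<dots> = G q" using G(2) q by simp
    finally show "f \<tau> \<in> G ` cball 0 \<rho>" using q by blast
  qed
  ultimately show ?thesis using bounded_subset by blast
qed

text \<open>
  Translation by \<open>N\<close> is the action of a unipotent matrix, which adds \<open>N s\<close> to \<open>t\<close>.
\<close>

lemma h_fun_periodic:
  fixes N :: int
  assumes \<tau>: "Im \<tau> > 0" and st: "(s, t) \<notin> \<int> \<times> \<int>" "(of_int r * s, of_int r * t) \<notin> \<int> \<times> \<int>"
    and N: "of_int N * s \<in> \<int>"
  shows "h_fun r (s, t) (\<tau> + of_int N) = h_fun r (s, t) \<tau>"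
proof -
  define A :: "int ^ 2 ^ 2" where "A = vector [vector [1, N], vector [0, 1]]"
  have A: "A $ 1 $ 1 = 1" "A $ 1 $ 2 = N" "A $ 2 $ 1 = 0" "A $ 2 $ 2 = 1" by (simp_all add: A_def)
  obtain j where j: "of_int N * s = of_int j" using N by (auto elim: Ints_cases)
  have "h_fun r (s, t) (\<tau> + of_int N) = slash 1 (h_fun r (s, t)) A \<tau>"
    by (simp add: slash_def A)
  also have "\<dots> = h_fun r (row_act (s, t) A) \<tau>"
    by (rule slash_h_fun[OF _ \<tau>]) (simp add: SL2Z_def det_2 A)
  also have "row_act (s, t) A = (s + of_int 0, t + of_int j)"
    using j by (simp add: row_act_def A mult.commute)
  also have "h_fun r \<dots> \<tau> = h_fun r (s, t) \<tau>"
    by (rule h_fun_shift_int[OF \<tau> st])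
  finally show ?thesis .
qed

lemma h_fun_bounded:
  assumes st: "(s, t) \<notin> \<int> \<times> \<int>" "(of_int r * s, of_int r * t) \<notin> \<int> \<times> \<int>"
  shows "bounded (h_fun r (s, t) ` {\<tau>. Im \<tau> > 1})"
proof -
  obtain N p q :: int where N: "N > 0" "of_int N * s = of_int p" "of_int N * t = of_int q"
    by (rule rat_common_denominator)
  obtain C where C: "\<And>\<tau>. Im \<tau> > 0 \<Longrightarrow> norm (h_fun r (s, t) \<tau>) \<le> C * (1 + norm \<tau>)\<^sup>2 * lattice_distortion \<tau> ^ 3"
    using h_fun_growth[OF st] by blast
  define w where "w = real_of_int N"
  have w: "w > 0" using N by (simp add: w_def)
  show ?thesis
  proof (rule periodic_polynomial_growth_imp_bounded[where w = w and k = 2 and C = "\<bar>C\<bar> * (2 + w)\<^sup>2 * (3 + w) ^ 3"])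
    show "h_fun r (s, t) holomorphic_on {\<tau>. Im \<tau> > 0}"
      using h_fun_holomorphic[OF st] by (simp add: upper_half_plane_def)
    show "h_fun r (s, t) (\<tau> + of_real w) = h_fun r (s, t) \<tau>" if "Im \<tau> > 0" for \<tau>
      using h_fun_periodic[OF that st, of N] N by (simp add: w_def)
  next
    fix \<tau> :: complex assume \<tau>: "Im \<tau> \<ge> 1" "\<bar>Re \<tau>\<bar> \<le> w"
    have "1 + norm \<tau> \<le> 1 + w + Im \<tau>"
      using cmod_le[of \<tau>] \<tau> by simp
    also have "\<dots> \<le> (2 + w) * Im \<tau>"
      using \<tau> w mult_left_mono[of 1 "Im \<tau>" "1 + w"] by (simp add: algebra_simps)
    finally have le: "1 + norm \<tau> \<le> (2 + w) * Im \<tau>" .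
    then have K: "lattice_distortion \<tau> \<le> 3 + w"
      using \<tau> by (simp add: lattice_distortion_def divide_le_eq)
    have "norm (h_fun r (s, t) \<tau>) \<le> C * (1 + norm \<tau>)\<^sup>2 * lattice_distortion \<tau> ^ 3"
      using \<tau> by (intro C) auto
    also have "\<dots> \<le> \<bar>C\<bar> * ((2 + w) * Im \<tau>)\<^sup>2 * (3 + w) ^ 3"
      using \<tau> w K le lattice_distortion_ge_1[of \<tau>] by (intro mult_mono power_mono) auto
    also have "\<dots> = \<bar>C\<bar> * (2 + w)\<^sup>2 * (3 + w) ^ 3 * Im \<tau> ^ 2"
      by (simp add: power_mult_distrib)
    finally show "norm (h_fun r (s, t) \<tau>) \<le> \<bar>C\<bar> * (2 + w)\<^sup>2 * (3 + w) ^ 3 * Im \<tau> ^ 2" .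
  qed (fact w)
qed

section \<open>Modularity\<close>

theorem theorem7:
  fixes s t :: rat and r :: int
  assumes "(s, t) \<notin> \<int> \<times> \<int>"
    and "r \<noteq> 0"
    and "(of_int r * s, of_int r * t) \<notin> \<int> \<times> \<int>"
  shows "modular_form 1 (Gamma_pt (s, t)) (h_fun r (s, t))"
  unfolding modular_form_def
proof (intro conjI ballI)
  note st = assms(1,3)
  show "h_fun r (s, t) holomorphic_on upper_half_plane"
    by (rule h_fun_holomorphic[OF st])
  {
    fix A \<tau> assume A: "A \<in> Gamma_pt (s, t)" and \<tau>: "\<tau> \<in> upper_half_plane"
    have "row_act (s, t) A - (s, t) \<in> \<int> \<times> \<int>" and SL: "A \<in> SL2Z"
      using A by (auto simp: Gamma_pt_def)
    then obtain i j where "row_act (s, t) A - (s, t) = (of_int i, of_int j)"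
      by (auto elim!: Ints_cases)
    then have "row_act (s, t) A = (s + of_int i, t + of_int j)"
      by (simp add: prod_eq_iff algebra_simps)
    then show "slash 1 (h_fun r (s, t)) A \<tau> = h_fun r (s, t) \<tau>"
      using slash_h_fun[OF SL] h_fun_shift_int[OF _ st] \<tau> by (simp add: upper_half_plane_def)
  next
    fix A assume A: "A \<in> SL2Z"
    obtain s' t' where st'_eq: "row_act (s, t) A = (s', t')" by fastforce
    have "row_act (of_int r * s, of_int r * t) A = (of_int r * s', of_int r * t')"
      using st'_eq by (auto simp: row_act_def algebra_simps)
    then have st': "(s', t') \<notin> \<int> \<times> \<int>" "(of_int r * s', of_int r * t') \<notin> \<int> \<times> \<int>"
      using row_act_in_Ints_iff[OF A] st st'_eq by metis+
    have "slash 1 (h_fun r (s, t)) A ` {\<tau>. Im \<tau> > 1} = h_fun r (s', t') ` {\<tau>. Im \<tau> > 1}"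
      using slash_h_fun[OF A] by (intro image_cong) (auto simp: st'_eq)
    with h_fun_bounded[OF st']
    show "\<exists>C>0. bounded (slash 1 (h_fun r (s, t)) A ` {\<tau>. Im \<tau> > C})"
      by (intro exI[of _ 1]) auto
  }
qed

end
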